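(* Let $k\ge 1$ be an integer and let $F=F_k\subset\mathbb{Z}$ be the set of $k$th-power-free integers. Then $F$ is uniformly discrete, but has gaps of arbitrary length. Moreover, for any integer $L>0$ the set of gaps of length at least $L$ has positive density; that is, the set of integers $x$ such that none of $x,x+1,\dots,x+L-1$ belongs to $F$ has positive natural density.
   Context: $F_k$ is the set of integers not divisible by $d^k$ for any integer $d>1$. A set $S\subset\mathbb{R}$ is uniformly discrete if there is $c>0$ such that $|x-y|\ge c$ for all distinct $x,y\in S$. A gap of length at least $L$ starting at $x$ means that none of the $L$ consecutive integers $x,x+1,\dots,x+L-1$ belongs to $F$. A set $X\subset\mathbb{Z}$ has natural density $\mathcal{D}$ if $|\{x\in X\mid|x|<R\}|/(2R)\to\mathcal{D}$ as $R\to\infty$. *)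

theory Defs
  imports "HOL-Analysis.Analysis"
begin

definition power_free :: "nat \<Rightarrow> int set" where
  "power_free k = {n. \<not> (\<exists>d::int. d > 1 \<and> d ^ k dvd n)}"

definition gap_starts :: "int set \<Rightarrow> int \<Rightarrow> int set" where
  "gap_starts F L = {x. \<forall>y\<in>{x..<x + L}. y \<notin> F}"

text \<open>Two-sided density on the integers, with the limit taken along real \<open>R\<close>; the limit is
  required to exist.\<close>

definition has_natural_density :: "int set \<Rightarrow> real \<Rightarrow> bool" where
  "has_natural_density X D \<longleftrightarrow>
     ((\<lambda>R::real. real (card {x \<in> X. \<bar>real_of_int x\<bar> < R}) / (2 * R)) \<longlongrightarrow> D) at_top"

end

theory Submission
  imports Defs "HOL-Number_Theory.Cong" "HOL-Computational_Algebra.Primes"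
begin

text \<open>
  Uniform discreteness is immediate, since distinct integers are at distance at least \<open>1\<close>. The
  Chinese remainder theorem, applied to the \<open>k\<close>th powers of \<open>L\<close> distinct primes, produces a whole
  residue class of starting points of gaps of length \<open>L\<close> (\<open>gap_starts_contain_residue_class\<close>).
  So gaps of every length exist, and the density of their starting points is positive as soon as
  it exists.

  Existence of the density is the real issue. For \<open>k \<ge> 2\<close>, the set of starting points is exhausted
  from inside by the sets \<open>bounded_gap_starts k L N\<close> on which every member of the gap is
  divisible by \<open>d ^ k\<close> for some \<open>d\<close> between \<open>2\<close> and \<open>N\<close>. Each of these is periodic and
  therefore has a density
  (\<open>has_natural_density_periodic\<close>). A point that is missed is at distance less than \<open>L\<close> from a
  nonzero multiple of some \<open>d ^ k\<close> with \<open>d > N\<close>. Since \<open>1 / d ^ k \<le> 1 / d\<^sup>2\<close>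
  has tail sums of order \<open>1 / N\<close>, the proportion of such points is \<open>O(L / N)\<close>, uniformly in all
  windows of radius at least \<open>L\<close>
  (\<open>unbounded_gap_starts_sparse\<close>). Such uniform inner approximation forces the density to exist
  (\<open>has_natural_density_inner_approx\<close>). For \<open>k = 1\<close> the harmonic series diverges, but then only
  \<open>1\<close> and \<open>- 1\<close> are power-free and the set of starting points is cofinite.
\<close>

section \<open>Natural density\<close>

lemma finite_window: "finite {x \<in> X. \<bar>real_of_int x\<bar> < R}"
proof (rule finite_subset)
  show "{x \<in> X. \<bar>real_of_int x\<bar> < R} \<subseteq> {- \<lceil>R\<rceil>..\<lceil>R\<rceil>}"
    by (auto simp: abs_less_iff) linarith+
qed simp

lemma card_window_mono:
  assumes "X \<subseteq> Y"
  shows "card {x \<in> X. \<bar>real_of_int x\<bar> < R} \<le> card {x \<in> Y. \<bar>real_of_int x\<bar> < R}"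
  using assms by (intro card_mono finite_window) auto

lemma card_window_Diff:
  assumes "X \<subseteq> Y"
  shows "real (card {x \<in> Y - X. \<bar>real_of_int x\<bar> < R}) =
    real (card {x \<in> Y. \<bar>real_of_int x\<bar> < R}) - real (card {x \<in> X. \<bar>real_of_int x\<bar> < R})"
proof -
  have "{x \<in> Y - X. \<bar>real_of_int x\<bar> < R} =
      {x \<in> Y. \<bar>real_of_int x\<bar> < R} - {x \<in> X. \<bar>real_of_int x\<bar> < R}"
    by auto
  moreover have "{x \<in> X. \<bar>real_of_int x\<bar> < R} \<subseteq> {x \<in> Y. \<bar>real_of_int x\<bar> < R}"
    using assms by auto
  ultimately show ?thesis
    using card_window_mono[OF assms] by (simp add: card_Diff_subset finite_window of_nat_diff)
qed

lemma has_natural_density_mono: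
  assumes "X \<subseteq> Y" "has_natural_density X D" "has_natural_density Y E"
  shows "D \<le> E"
proof (rule tendsto_le[OF _ assms(3)[unfolded has_natural_density_def]
      assms(2)[unfolded has_natural_density_def]])
  show "\<forall>\<^sub>F R in at_top. real (card {x \<in> X. \<bar>real_of_int x\<bar> < R}) / (2 * R)
      \<le> real (card {x \<in> Y. \<bar>real_of_int x\<bar> < R}) / (2 * R)"
    using eventually_gt_at_top[of 0]
    by eventually_elim (use card_window_mono[OF assms(1)] in \<open>auto intro!: divide_right_mono\<close>)
qed simp

lemma has_natural_density_Diff:
  assumes "X \<subseteq> Y" "has_natural_density X D" "has_natural_density Y E"
  shows "has_natural_density (Y - X) (E - D)"
  using tendsto_diff[OF assms(3,2)[unfolded has_natural_density_def]]
  unfolding has_natural_density_def card_window_Diff[OF assms(1)] diff_divide_distrib .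

lemma has_natural_density_finite:
  assumes "finite X"
  shows "has_natural_density X 0"
  unfolding has_natural_density_def
proof (rule tendsto_sandwich)
  show "\<forall>\<^sub>F R in at_top. 0 \<le> real (card {x \<in> X. \<bar>real_of_int x\<bar> < R}) / (2 * R)"
    using eventually_gt_at_top[of 0] by eventually_elim simp
  show "\<forall>\<^sub>F R in at_top.
      real (card {x \<in> X. \<bar>real_of_int x\<bar> < R}) / (2 * R) \<le> (real (card X) / 2) / R"
    using eventually_gt_at_top[of 0]
    by eventually_elim
      (use card_mono[OF assms, of "{x \<in> X. \<bar>real_of_int x\<bar> < _}"] in
        \<open>auto simp: field_simps\<close>)
  show "((\<lambda>R. (real (card X) / 2) / R) \<longlongrightarrow> 0) at_top"
    by (intro tendsto_divide_0[OF tendsto_const] filterlim_at_top_imp_at_infinity filterlim_ident)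
qed simp

lemma card_residue_class_window:
  fixes m r :: int
  assumes "m > 0" "R > 0"
  shows "\<bar>real (card {x \<in> {x. m dvd x - r}. \<bar>real_of_int x\<bar> < R}) - 2 * R / m\<bar> \<le> 1"
proof -
  let ?a = "(- R - r) / m" and ?b = "(R - r) / m"
  have iff: "\<bar>real_of_int (r + m * t)\<bar> < R \<longleftrightarrow> t \<in> {\<lfloor>?a\<rfloor> <..< \<lceil>?b\<rceil>}" for t
  proof -
    have "\<bar>real_of_int (r + m * t)\<bar> < R \<longleftrightarrow> ?a < t \<and> t < ?b"
      using assms by (auto simp: field_simps abs_less_iff)
    also have "\<dots> \<longleftrightarrow> t \<in> {\<lfloor>?a\<rfloor> <..< \<lceil>?b\<rceil>}"
      by (simp add: floor_less_iff less_ceiling_iff)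
    finally show ?thesis .
  qed
  have "{x \<in> {x. m dvd x - r}. \<bar>real_of_int x\<bar> < R} = (\<lambda>t. r + m * t) ` {\<lfloor>?a\<rfloor> <..< \<lceil>?b\<rceil>}"
  proof (intro set_eqI iffI)
    fix x assume x: "x \<in> {x \<in> {x. m dvd x - r}. \<bar>real_of_int x\<bar> < R}"
    then obtain t where "x - r = m * t" by blast
    then have "x = r + m * t" by simp
    with x iff[of t] show "x \<in> (\<lambda>t. r + m * t) ` {\<lfloor>?a\<rfloor> <..< \<lceil>?b\<rceil>}" by auto
  next
    fix x assume "x \<in> (\<lambda>t. r + m * t) ` {\<lfloor>?a\<rfloor> <..< \<lceil>?b\<rceil>}"
    then obtain t where "x = r + m * t" "t \<in> {\<lfloor>?a\<rfloor> <..< \<lceil>?b\<rceil>}" by blast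
    with iff[of t] show "x \<in> {x \<in> {x. m dvd x - r}. \<bar>real_of_int x\<bar> < R}" by simp
  qed
  moreover have "inj_on (\<lambda>t. r + m * t) S" for S using assms by (auto simp: inj_on_def)
  ultimately have card: "card {x \<in> {x. m dvd x - r}. \<bar>real_of_int x\<bar> < R} = nat (\<lceil>?b\<rceil> - \<lfloor>?a\<rfloor> - 1)"
    by (simp add: card_image)
  have ab: "?b - ?a = 2 * R / m" using assms by (simp add: field_simps)
  have pos: "?b - ?a > 0" unfolding ab using assms by simp
  have "\<lceil>?b\<rceil> - \<lfloor>?a\<rfloor> - 1 \<ge> 0" using pos by linarith
  then have "real (nat (\<lceil>?b\<rceil> - \<lfloor>?a\<rfloor> - 1)) = real_of_int \<lceil>?b\<rceil> - real_of_int \<lfloor>?a\<rfloor> - 1" by simp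
  then show ?thesis unfolding card ab[symmetric] by linarith
qed

lemma has_natural_density_residue_class:
  fixes m r :: int
  assumes "m > 0"
  shows "has_natural_density {x. m dvd x - r} (1 / m)"
  unfolding has_natural_density_def
proof (rule Lim_transform[where g = "\<lambda>_. 1 / m"])
  let ?c = "\<lambda>R. real (card {x \<in> {x. m dvd x - r}. \<bar>real_of_int x\<bar> < R})"
  show "((\<lambda>R. ?c R / (2 * R) - 1 / m) \<longlongrightarrow> 0) at_top"
  proof (rule Lim_null_comparison)
    show "\<forall>\<^sub>F R in at_top. norm (?c R / (2 * R) - 1 / m) \<le> (1 / 2) / R"
      using eventually_gt_at_top[of 0]
    proof eventually_elim
      case (elim R)
      have "?c R / (2 * R) - 1 / m = (?c R - 2 * R / m) / (2 * R)"
        using elim assms by (simp add: field_simps)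
      then have "norm (?c R / (2 * R) - 1 / m) = \<bar>?c R - 2 * R / m\<bar> / (2 * R)"
        using elim by simp
      also have "\<dots> \<le> 1 / (2 * R)"
        using card_residue_class_window[OF assms elim] elim by (intro divide_right_mono) auto
      finally show ?case by simp
    qed
    show "((\<lambda>R::real. (1 / 2) / R) \<longlongrightarrow> 0) at_top"
      by (intro tendsto_divide_0[OF tendsto_const] filterlim_at_top_imp_at_infinity filterlim_ident)
  qed
qed simp

lemma has_natural_density_UNIV: "has_natural_density UNIV 1"
  using has_natural_density_residue_class[of 1 0] by simp

text \<open>A periodic set is a finite disjoint union of residue classes.\<close>

lemma has_natural_density_periodic:
  fixes m :: int
  assumes "m > 0" and periodic: "\<And>x y. m dvd x - y \<Longrightarrow> x \<in> X \<Longrightarrow> y \<in> X"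
  shows "\<exists>D. has_natural_density X D"
proof -
  let ?C = "\<lambda>R r. {x \<in> {x. m dvd x - r}. \<bar>real_of_int x\<bar> < R}"
  have split: "{x \<in> X. \<bar>real_of_int x\<bar> < R} = (\<Union>r\<in>X \<inter> {0..<m}. ?C R r)" for R
  proof (intro set_eqI iffI)
    fix x assume x: "x \<in> {x \<in> X. \<bar>real_of_int x\<bar> < R}"
    have "m dvd x - x mod m" by simp
    with x periodic[of x "x mod m"] have "x mod m \<in> X \<inter> {0..<m}" "x \<in> ?C R (x mod m)"
      using assms(1) by auto
    then show "x \<in> (\<Union>r\<in>X \<inter> {0..<m}. ?C R r)" by blast
  next
    fix x assume "x \<in> (\<Union>r\<in>X \<inter> {0..<m}. ?C R r)"
    then obtain r where "r \<in> X" "m dvd x - r" "\<bar>real_of_int x\<bar> < R" by auto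
    then show "x \<in> {x \<in> X. \<bar>real_of_int x\<bar> < R}"
      using periodic[of r x] by (auto simp: dvd_diff_commute)
  qed
  have disjoint: "?C R r \<inter> ?C R s = {}" if "r \<in> X \<inter> {0..<m}" "s \<in> X \<inter> {0..<m}" "r \<noteq> s" for R r s
  proof -
    have "r = s" if "m dvd x - r" "m dvd x - s" for x
    proof -
      have "r mod m = s mod m" using that by (metis mod_eq_dvd_iff)
      then show ?thesis using \<open>r \<in> _\<close> \<open>s \<in> _\<close> by simp
    qed
    with that show ?thesis by blast
  qed
  have "finite (?C R r)" for R r by (rule finite_window)
  then have "real (card {x \<in> X. \<bar>real_of_int x\<bar> < R}) / (2 * R) =
      (\<Sum>r\<in>X \<inter> {0..<m}. real (card (?C R r)) / (2 * R))" for R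
    unfolding split using disjoint
    by (subst card_UN_disjoint) (auto simp: sum_divide_distrib)
  moreover have "((\<lambda>R. \<Sum>r\<in>X \<inter> {0..<m}. real (card (?C R r)) / (2 * R))
      \<longlongrightarrow> (\<Sum>r\<in>X \<inter> {0..<m}. 1 / m)) at_top"
    by (intro tendsto_sum has_natural_density_residue_class[unfolded has_natural_density_def] assms)
  ultimately show ?thesis unfolding has_natural_density_def by auto
qed

text \<open>
  The density is the supremum of the densities of the subsets that have one: a subset that
  misses at most a proportion \<open>e\<close> of \<open>X\<close> in all large windows has a density within \<open>e\<close> of that
  supremum, and within \<open>e\<close> of the proportion of \<open>X\<close> in large windows, up to a vanishing error.
\<close>

lemma has_natural_density_inner_approx:
  assumes approx: "\<And>e. e > 0 \<Longrightarrow> \<exists>A D. A \<subseteq> X \<and> has_natural_density A D \<and>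
    (\<forall>\<^sub>F R in at_top. real (card {x \<in> X - A. \<bar>real_of_int x\<bar> < R}) / (2 * R) \<le> e)"
  shows "\<exists>D. has_natural_density X D"
proof -
  let ?f = "\<lambda>A R. real (card {x \<in> A. \<bar>real_of_int x\<bar> < R}) / (2 * R)"
  define Ds where "Ds = {D. \<exists>A \<subseteq> X. has_natural_density A D}"
  have Ds_bdd: "bdd_above Ds"
    using has_natural_density_mono[OF _ _ has_natural_density_UNIV]
    by (intro bdd_aboveI[of _ 1]) (auto simp: Ds_def)
  have "has_natural_density X (Sup Ds)"
    unfolding has_natural_density_def
  proof (rule tendstoI)
    fix e :: real assume "e > 0"
    then obtain A D where A: "A \<subseteq> X" "has_natural_density A D"
      and missed: "\<forall>\<^sub>F R in at_top. ?f (X - A) R \<le> e / 4"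
      using approx[of "e / 4"] by auto
    have missed_eq: "?f (X - A) R = ?f X R - ?f A R" for R
      by (simp only: card_window_Diff[OF A(1)] diff_divide_distrib)
    have D_le: "D \<le> Sup Ds"
      using A Ds_bdd by (intro cSup_upper) (auto simp: Ds_def)
    have Sup_le: "Sup Ds \<le> D + e / 4"
    proof (rule cSup_least)
      show "Ds \<noteq> {}" using A by (auto simp: Ds_def)
      fix E assume "E \<in> Ds"
      then obtain B where B: "B \<subseteq> X" "has_natural_density B E" by (auto simp: Ds_def)
      show "E \<le> D + e / 4"
      proof (rule tendsto_le)
        show "((\<lambda>R. ?f A R + e / 4) \<longlongrightarrow> D + e / 4) at_top"
          using A(2) unfolding has_natural_density_def by (intro tendsto_intros)
        show "(?f B \<longlongrightarrow> E) at_top" using B(2) unfolding has_natural_density_def .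
        show "\<forall>\<^sub>F R in at_top. ?f B R \<le> ?f A R + e / 4"
          using missed eventually_gt_at_top[of 0]
        proof eventually_elim
          case (elim R)
          have "?f B R \<le> ?f X R"
            using card_window_mono[OF B(1), of R] elim(2) by (intro divide_right_mono) auto
          with elim(1) show ?case unfolding missed_eq by linarith
        qed
      qed simp
    qed
    have "\<forall>\<^sub>F R in at_top. dist (?f A R) D < e / 4"
      using A(2) \<open>e > 0\<close> unfolding has_natural_density_def by (intro tendstoD) auto
    with missed show "\<forall>\<^sub>F R in at_top. dist (?f X R) (Sup Ds) < e"
      using eventually_gt_at_top[of 0]
    proof eventually_elim
      case (elim R)
      have "?f X R - ?f A R \<le> e / 4"
        using elim(1) unfolding missed_eq .
      moreover have "?f A R \<le> ?f X R"
        using card_window_mono[OF A(1), of R] elim(3) by (intro divide_right_mono) auto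
      ultimately show ?case using elim(2) D_le Sup_le \<open>e > 0\<close> unfolding dist_real_def by linarith
    qed
  qed
  then show ?thesis ..
qed

section \<open>Gaps between power-free integers\<close>

lemma mem_gap_starts_power_free:
  "x \<in> gap_starts (power_free k) L \<longleftrightarrow> (\<forall>y\<in>{x..<x + L}. \<exists>d>1. d ^ k dvd y)"
  by (auto simp: gap_starts_def power_free_def)

text \<open>
  With \<open>p i\<close> distinct primes, solve \<open>x + i \<equiv> 0\<close> modulo \<open>p i ^ k\<close> for all \<open>i < L\<close> at once; the
  solutions form a residue class modulo the product of the moduli.
\<close>

lemma gap_starts_contain_residue_class:
  "\<exists>m x. m > 0 \<and> {t. m dvd t - x} \<subseteq> gap_starts (power_free k) L"
proof -
  obtain p :: "nat \<Rightarrow> nat" where p: "inj p" "range p \<subseteq> {p. prime p}"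
    using infinite_countable_subset[OF primes_infinite] by blast
  have prime: "prime (p i)" for i using p(2) by auto
  have gt0: "p i ^ k > 0" for i using prime_gt_0_nat[OF prime] by simp
  have "coprime (p i ^ k) (p j ^ k)" if "i \<noteq> j" for i j
    using that p(1) prime by (metis coprime_power_left_iff coprime_power_right_iff injD primes_coprime)
  \<comment> \<open>A nonnegative representative of \<open>- i\<close> modulo \<open>p i ^ k\<close> is \<open>(p i ^ k - 1) * i\<close>.\<close>
  then obtain x where x: "\<forall>i\<in>{..<nat L}. [x = (p i ^ k - 1) * i] (mod p i ^ k)"
    using chinese_remainder_nat[of "{..<nat L}" "\<lambda>i. p i ^ k" "\<lambda>i. (p i ^ k - 1) * i"] by auto
  define m where "m = (\<Prod>i<nat L. int (p i ^ k))"
  have "m > 0" unfolding m_def using gt0 by (intro prod_pos) (simp only: of_nat_0_less_iff)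
  moreover have "t \<in> gap_starts (power_free k) L" if "m dvd t - int x" for t
    unfolding mem_gap_starts_power_free
  proof
    fix y assume y: "y \<in> {t..<t + L}"
    define i where "i = nat (y - t)"
    have i: "i \<in> {..<nat L}" "y = t + int i" using y by (auto simp: i_def)
    have "[x + i = (p i ^ k - 1) * i + i] (mod p i ^ k)" using x i(1) by (simp add: cong_add_rcancel_nat)
    moreover have "(p i ^ k - 1) * i + i = p i ^ k * i"
    proof -
      have "(p i ^ k - 1) * i + i = Suc (p i ^ k - 1) * i" by simp
      then show ?thesis unfolding Suc_diff_1[OF gt0] .
    qed
    ultimately have "p i ^ k dvd x + i" by (simp add: cong_dvd_iff)
    then have "int (p i ^ k) dvd int (x + i)" by (simp only: int_dvd_int_iff)
    then have "int (p i) ^ k dvd int x + int i" by simp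
    moreover have "int (p i) ^ k dvd m"
      unfolding m_def using dvd_prodI[OF finite_lessThan i(1), of "\<lambda>i. int (p i ^ k)"] by simp
    then have "int (p i) ^ k dvd t - int x" using that by (rule dvd_trans)
    ultimately have "int (p i) ^ k dvd (int x + int i) + (t - int x)" by (rule dvd_add)
    also have "(int x + int i) + (t - int x) = y" unfolding i(2) by simp
    finally have "int (p i) ^ k dvd y" .
    moreover have "int (p i) > 1" using prime_gt_1_nat[OF prime[of i]] by simp
    ultimately show "\<exists>d>1. d ^ k dvd y" by blast
  qed
  ultimately show ?thesis by blast
qed

definition bounded_gap_starts :: "nat \<Rightarrow> int \<Rightarrow> nat \<Rightarrow> int set" where
  "bounded_gap_starts k L N = {x. \<forall>y\<in>{x..<x + L}. \<exists>d\<in>{2..N}. int d ^ k dvd y}"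

lemma bounded_gap_starts_subset: "bounded_gap_starts k L N \<subseteq> gap_starts (power_free k) L"
  unfolding bounded_gap_starts_def
proof clarify
  fix x assume x: "\<forall>y\<in>{x..<x + L}. \<exists>d\<in>{2..N}. int d ^ k dvd y"
  show "x \<in> gap_starts (power_free k) L"
    unfolding mem_gap_starts_power_free
  proof
    fix y assume "y \<in> {x..<x + L}"
    with x obtain d where "d \<in> {2..N}" "int d ^ k dvd y" by blast
    then show "\<exists>d>1. d ^ k dvd y" by (intro exI[of _ "int d"]) auto
  qed
qed

lemma has_natural_density_bounded_gap_starts:
  "\<exists>D. has_natural_density (bounded_gap_starts k L N) D"
proof (rule has_natural_density_periodic)
  let ?m = "\<Prod>d=2..N. int d ^ k"
  show "?m > 0" by (intro prod_pos) auto
  fix x x' assume per: "?m dvd x - x'" and x: "x \<in> bounded_gap_starts k L N"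
  show "x' \<in> bounded_gap_starts k L N"
    unfolding bounded_gap_starts_def
  proof clarify
    fix y assume "y \<in> {x'..<x' + L}"
    then have "y + (x - x') \<in> {x..<x + L}" by auto
    then obtain d where d: "d \<in> {2..N}" "int d ^ k dvd y + (x - x')"
      using x unfolding bounded_gap_starts_def by blast
    have "int d ^ k dvd ?m" using d(1) by (intro dvd_prodI) auto
    then have "int d ^ k dvd x - x'" using per by (rule dvd_trans)
    then have "int d ^ k dvd y" using d(2) by (simp add: dvd_add_left_iff)
    then show "\<exists>d\<in>{2..N}. int d ^ k dvd y" using d(1) by blast
  qed
qed

lemma sum_inverse_squares_tail:
  assumes "N > 0"
  shows "(\<Sum>d=Suc N..M. 1 / (real d)\<^sup>2) \<le> 1 / N"
proof -
  have "(\<Sum>d=Suc N..M. 1 / (real d)\<^sup>2) \<le> 1 / N - 1 / M" if "N \<le> M"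
    using that
  proof (induction rule: dec_induct)
    case (step n)
    \<comment> \<open>The sum of the upper bounds \<open>1 / (n * (n + 1))\<close> telescopes.\<close>
    have n: "n > 0" using step.hyps assms by simp
    then have "1 / (real (Suc n))\<^sup>2 \<le> 1 / (real n * real (Suc n))"
      by (intro divide_left_mono) (auto simp: power2_eq_square)
    also have "\<dots> = 1 / n - 1 / Suc n" using n by (simp add: field_simps)
    finally have "1 / (real (Suc n))\<^sup>2 \<le> 1 / n - 1 / Suc n" .
    with step show ?case by simp
  qed simp
  then show ?thesis
    by (cases "N \<le> M") (auto intro: order_trans[of _ "1 / N - 1 / M"])
qed

text \<open>
  Leaving out the multiple \<open>0\<close> removes the additive error of \<open>card_residue_class_window\<close>, so that
  the bounds can be summed over all square moduli \<open>m\<close> with a total proportional to \<open>T\<close>.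
\<close>

lemma card_nonzero_multiples_le:
  fixes m :: nat
  assumes "m > 0" "T > 0"
  shows "real (card {y::int. y \<noteq> 0 \<and> int m dvd y \<and> \<bar>real_of_int y\<bar> < T}) \<le> 2 * T / m"
proof -
  let ?q = "\<lfloor>T / m\<rfloor>"
  have "{y::int. y \<noteq> 0 \<and> int m dvd y \<and> \<bar>real_of_int y\<bar> < T}
      \<subseteq> (\<lambda>t. int m * t) ` ({- ?q..- 1} \<union> {1..?q})"
  proof
    fix y assume y: "y \<in> {y::int. y \<noteq> 0 \<and> int m dvd y \<and> \<bar>real_of_int y\<bar> < T}"
    then obtain t where t: "y = int m * t" by blast
    with y have t0: "t \<noteq> 0" by auto
    have "\<bar>real_of_int (int m * t)\<bar> < T" using y unfolding t by blast
    then have "real m * \<bar>real_of_int t\<bar> < T" by (simp add: abs_mult)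
    then have "real_of_int \<bar>t\<bar> \<le> T / m" using assms by (simp add: field_simps)
    then have "\<bar>t\<bar> \<le> ?q" by (simp only: le_floor_iff)
    with t0 have "t \<in> {- ?q..- 1} \<union> {1..?q}"
      unfolding Un_iff atLeastAtMost_iff by linarith
    with t show "y \<in> (\<lambda>t. int m * t) ` ({- ?q..- 1} \<union> {1..?q})" by (rule image_eqI)
  qed
  then have "card {y::int. y \<noteq> 0 \<and> int m dvd y \<and> \<bar>real_of_int y\<bar> < T} \<le> card ({- ?q..- 1} \<union> {1..?q})"
    by (intro surj_card_le) auto
  also have "\<dots> \<le> card {- ?q..- 1} + card {1..?q}" by (rule card_Un_le)
  finally have "real (card {y::int. y \<noteq> 0 \<and> int m dvd y \<and> \<bar>real_of_int y\<bar> < T}) \<le> 2 * real (nat ?q)"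
    by simp
  also have "\<dots> = 2 * real_of_int ?q" using assms by simp
  also have "\<dots> \<le> 2 * (T / m)" by (intro mult_left_mono of_int_floor_le) simp
  finally show ?thesis by simp
qed

lemma card_multiples_of_large_squares_le:
  assumes "N > 0" "T > 0"
  defines "Y \<equiv> {y::int. y \<noteq> 0 \<and> \<bar>real_of_int y\<bar> < T \<and> (\<exists>d>N. int (d\<^sup>2) dvd y)}"
  shows "finite Y" and "real (card Y) \<le> 2 * T / N"
proof -
  let ?M = "\<lambda>d. {y::int. y \<noteq> 0 \<and> int (d\<^sup>2) dvd y \<and> \<bar>real_of_int y\<bar> < T}"
  show "finite Y" by (rule finite_subset[OF _ finite_window[of UNIV T]]) (auto simp: Y_def)
  have sub: "Y \<subseteq> (\<Union>d\<in>{Suc N..nat \<lceil>T\<rceil>}. ?M d)"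
  proof
    fix y assume "y \<in> Y"
    then obtain d where d: "y \<noteq> 0" "\<bar>real_of_int y\<bar> < T" "d > N" "int (d\<^sup>2) dvd y"
      by (auto simp: Y_def)
    have "d \<le> d\<^sup>2" by (simp add: power2_eq_square)
    then have "int d \<le> int (d\<^sup>2)" by (simp only: of_nat_le_iff)
    also have "\<dots> \<le> \<bar>y\<bar>" using dvd_imp_le_int[OF d(1,4)] by simp
    finally have "real_of_int (int d) \<le> real_of_int \<bar>y\<bar>" by (simp only: of_int_le_iff)
    with d(2) have "real d \<le> T" by simp
    then have "d \<le> nat \<lceil>T\<rceil>" by linarith
    with d show "y \<in> (\<Union>d\<in>{Suc N..nat \<lceil>T\<rceil>}. ?M d)" by auto
  qed
  have "card Y \<le> card (\<Union>d\<in>{Suc N..nat \<lceil>T\<rceil>}. ?M d)"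
    by (rule card_mono[OF finite_subset[OF _ finite_window[of UNIV T]] sub]) auto
  also have "\<dots> \<le> (\<Sum>d=Suc N..nat \<lceil>T\<rceil>. card (?M d))" by (rule card_UN_le) simp
  finally have "real (card Y) \<le> (\<Sum>d=Suc N..nat \<lceil>T\<rceil>. real (card (?M d)))"
    unfolding of_nat_sum[symmetric] by (simp only: of_nat_le_iff)
  also have "\<dots> \<le> (\<Sum>d=Suc N..nat \<lceil>T\<rceil>. 2 * T / real (d\<^sup>2))"
    using assms by (intro sum_mono card_nonzero_multiples_le) auto
  also have "\<dots> = 2 * T * (\<Sum>d=Suc N..nat \<lceil>T\<rceil>. 1 / (real d)\<^sup>2)"
    by (simp add: sum_distrib_left)
  also have "\<dots> \<le> 2 * T * (1 / N)"
    using assms sum_inverse_squares_tail by (intro mult_left_mono) auto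
  finally show "real (card Y) \<le> 2 * T / N" by simp
qed

text \<open>
  If \<open>x\<close> starts a gap but not one witnessed by divisors up to \<open>N\<close>, then some \<open>x + i\<close> in the gap
  is a multiple of \<open>d ^ k\<close>, hence of \<open>d\<^sup>2\<close>, for some \<open>d > N\<close>. It is nonzero because \<open>0\<close> is
  a multiple of \<open>2 ^ k\<close> and \<open>2 \<le> N\<close>.
\<close>

lemma unbounded_gap_starts_sparse:
  assumes "k \<ge> 2" "N \<ge> 2" "L > 0" "R \<ge> real_of_int L"
  shows "real (card {x \<in> gap_starts (power_free k) L - bounded_gap_starts k L N. \<bar>real_of_int x\<bar> < R})
    / (2 * R) \<le> 2 * real_of_int L / N"
proof -
  let ?Z = "{x \<in> gap_starts (power_free k) L - bounded_gap_starts k L N. \<bar>real_of_int x\<bar> < R}"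
  \<comment> \<open>A gap that starts inside the window of radius \<open>R\<close> reaches past it by less than \<open>L\<close>.\<close>
  define T where "T = R + L"
  define Y where "Y = {y::int. y \<noteq> 0 \<and> \<bar>real_of_int y\<bar> < T \<and> (\<exists>d>N. int (d\<^sup>2) dvd y)}"
  have R: "R > 0" using assms by linarith
  then have T: "T > 0" using assms by (simp add: T_def)
  have Y: "finite Y" "real (card Y) \<le> 2 * T / N"
    unfolding Y_def using card_multiples_of_large_squares_le[of N T] assms T by auto
  have sub: "?Z \<subseteq> (\<lambda>(i, y). y - i) ` ({0..<L} \<times> Y)"
  proof
    fix x assume x: "x \<in> ?Z"
    then obtain y where y: "y \<in> {x..<x + L}" "\<And>d. d \<in> {2..N} \<Longrightarrow> \<not> int d ^ k dvd y"
      unfolding bounded_gap_starts_def by blast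
    then obtain d where d: "d > 1" "d ^ k dvd y"
      using x mem_gap_starts_power_free by blast
    have "nat d \<ge> 2" using d(1) by linarith
    moreover have "int (nat d) ^ k dvd y" using d by simp
    ultimately have "N < nat d"
      using y(2)[of "nat d"] unfolding atLeastAtMost_iff by linarith
    moreover have "int ((nat d)\<^sup>2) dvd y"
      using d assms(1) power_le_dvd[of d k y 2] by auto
    moreover have "y \<noteq> 0" using y(2)[of 2] assms(2) by auto
    moreover have "\<bar>real_of_int y\<bar> < T"
    proof -
      have "real_of_int y < real_of_int x + real_of_int L" "real_of_int x \<le> real_of_int y"
        using y(1) by (simp_all flip: of_int_add)
      then show ?thesis using x assms(3) by (auto simp: T_def abs_less_iff)
    qed
    ultimately have "y \<in> Y" by (auto simp: Y_def)
    moreover have "y - x \<in> {0..<L}" using y(1) by auto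
    ultimately show "x \<in> (\<lambda>(i, y). y - i) ` ({0..<L} \<times> Y)"
      by (intro image_eqI[of _ _ "(y - x, y)"]) auto
  qed
  have "card ?Z \<le> card ({0..<L} \<times> Y)"
    using surj_card_le[OF _ sub] Y(1) by simp
  also have "\<dots> = nat L * card Y" by (simp add: card_cartesian_product)
  finally have "real (card ?Z) \<le> real (nat L * card Y)" by (simp only: of_nat_le_iff)
  also have "\<dots> = real_of_int L * real (card Y)" using assms(3) by simp
  also have "\<dots> \<le> real_of_int L * (2 * T / N)"
    using Y(2) assms(3) by (intro mult_left_mono) auto
  also have "\<dots> \<le> real_of_int L * (2 * (2 * R) / N)"
    using assms by (intro mult_left_mono divide_right_mono) (auto simp: T_def)
  finally show ?thesis using R assms(2) by (simp add: field_simps)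
qed

lemma gap_starts_power_free_has_density:
  assumes "k \<ge> 2" "L > 0"
  shows "\<exists>D. has_natural_density (gap_starts (power_free k) L) D"
proof (rule has_natural_density_inner_approx)
  fix e :: real assume "e > 0"
  define N where "N = max 2 (nat \<lceil>2 * real_of_int L / e\<rceil>)"
  have N: "N \<ge> 2" by (simp add: N_def)
  have "2 * real_of_int L / e \<le> N" unfolding N_def by linarith
  then have small: "2 * real_of_int L / N \<le> e" using \<open>e > 0\<close> N by (simp add: field_simps)
  obtain D where "has_natural_density (bounded_gap_starts k L N) D"
    using has_natural_density_bounded_gap_starts by blast
  moreover have "\<forall>\<^sub>F R in at_top. real (card {x \<in> gap_starts (power_free k) L -
      bounded_gap_starts k L N. \<bar>real_of_int x\<bar> < R}) / (2 * R) \<le> e"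
    using eventually_ge_at_top[of "real_of_int L"]
    by eventually_elim (use unbounded_gap_starts_sparse[OF assms(1) N assms(2)] small in force)
  ultimately show "\<exists>A D. A \<subseteq> gap_starts (power_free k) L \<and> has_natural_density A D \<and>
      (\<forall>\<^sub>F R in at_top. real (card {x \<in> gap_starts (power_free k) L - A. \<bar>real_of_int x\<bar> < R})
        / (2 * R) \<le> e)"
    using bounded_gap_starts_subset by blast
qed

lemma power_free_1: "power_free 1 = {1, - 1}"
proof -
  have "(\<exists>d>1. d dvd n) \<longleftrightarrow> n \<noteq> 1 \<and> n \<noteq> - 1" for n :: int
  proof
    show "n \<noteq> 1 \<and> n \<noteq> - 1" if "\<exists>d>1. d dvd n"
      using that by (auto dest: zdvd_imp_le)
    assume n: "n \<noteq> 1 \<and> n \<noteq> - 1"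
    show "\<exists>d>1. d dvd n"
    proof (cases "n = 0")
      case True
      then show ?thesis by (intro exI[of _ 2]) auto
    next
      case False
      with n show ?thesis by (intro exI[of _ "\<bar>n\<bar>"]) auto
    qed
  qed
  then show ?thesis by (auto simp: power_free_def)
qed

lemma has_natural_density_gap_starts_finite:
  assumes "finite F"
  shows "has_natural_density (gap_starts F L) 1"
proof -
  let ?B = "(\<lambda>(i, y). y - i) ` ({0..<L} \<times> F)"
  have "x \<notin> gap_starts F L \<longleftrightarrow> x \<in> ?B" for x
  proof
    assume "x \<notin> gap_starts F L"
    then obtain y where "y \<in> {x..<x + L}" "y \<in> F" by (auto simp: gap_starts_def)
    then show "x \<in> ?B" by (intro image_eqI[of _ _ "(y - x, y)"]) auto
  next
    assume "x \<in> ?B"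
    then obtain i y where "x = y - i" "i \<in> {0..<L}" "y \<in> F" by auto
    then show "x \<notin> gap_starts F L" by (auto simp: gap_starts_def intro!: bexI[of _ y])
  qed
  then have "gap_starts F L = UNIV - ?B" by blast
  moreover have "has_natural_density (UNIV - ?B) (1 - 0)"
    using assms by (intro has_natural_density_Diff has_natural_density_UNIV
        has_natural_density_finite finite_imageI) auto
  ultimately show ?thesis by simp
qed

theorem proposition10:
  fixes k :: nat
  assumes "k \<ge> 1"
  shows "uniform_discrete (real_of_int ` power_free k)
    \<and> (\<forall>L::int. L > 0 \<longrightarrow> gap_starts (power_free k) L \<noteq> {})
    \<and> (\<forall>L::int. L > 0 \<longrightarrow> (\<exists>D::real. D > 0 \<and> has_natural_density (gap_starts (power_free k) L) D))"
proof (intro conjI allI impI)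
  show "uniform_discrete (real_of_int ` power_free k)"
    unfolding uniform_discrete_def
    by (intro exI[of _ 1]) (auto simp: dist_real_def simp flip: of_int_diff of_int_abs)
next
  fix L :: int
  obtain m x where m: "m > 0" "{t. m dvd t - x} \<subseteq> gap_starts (power_free k) L"
    using gap_starts_contain_residue_class by blast
  then have "x \<in> gap_starts (power_free k) L" by auto
  then show "gap_starts (power_free k) L \<noteq> {}" by blast
next
  fix L :: int
  assume "L > 0"
  obtain D where D: "has_natural_density (gap_starts (power_free k) L) D"
  proof (cases "k = 1")
    case True
    have "has_natural_density (gap_starts (power_free 1) L) 1"
      unfolding power_free_1 by (rule has_natural_density_gap_starts_finite) simp
    then show ?thesis using that True by blast
  next
    case False
    then show ?thesis
      using assms gap_starts_power_free_has_density[of k L] \<open>L > 0\<close> that by fastforce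
  qed
  obtain m x where m: "m > 0" "{t. m dvd t - x} \<subseteq> gap_starts (power_free k) L"
    using gap_starts_contain_residue_class by blast
  have "1 / m \<le> D"
    using has_natural_density_mono[OF m(2) has_natural_density_residue_class[OF m(1)] D] .
  moreover have "1 / real_of_int m > 0" using m(1) by simp
  ultimately show "\<exists>D>0. has_natural_density (gap_starts (power_free k) L) D"
    using D by (intro exI[of _ D]) linarith
qed

end
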